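(* Let $V$ be a finite dimensional $\mathbb{R}$-vector space equipped with a positive definite symmetric bilinear form (metric) $b$ and a non-degenerate $\mathbb{R}$-valued skew-symmetric bilinear form $\omega$. Then there exists a unique complex structure $J$ on $V$ such that (1) $b(Jx,Jy)=b(x,y)$ for all $x,y\in V$; (2) $\omega(Jx,Jy)=\omega(x,y)$ for all $x,y\in V$; (3) the form $b_{\omega,J}$ defined by $b_{\omega,J}(x,y):=\omega(x,Jy)$ is a positive definite metric on $V$ (that is, symmetric and positive definite).
   Context: A complex structure on a real vector space $V$ is an $\mathbb{R}$-linear map $J:V\to V$ with $J^2=-\mathrm{id}_V$. *)

theory Defs
  imports "HOL-Analysis.Analysis"
begin

text \<open>A metric is only required to be a positive definite symmetric bilinear form on the real
  vector space; it need not be the norm or inner product of a type class.\<close>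

definition metric_form :: "('a::real_vector \<Rightarrow> 'a \<Rightarrow> real) \<Rightarrow> bool" where
  "metric_form b \<longleftrightarrow>
    bilinear b \<and> (\<forall>x y. b x y = b y x) \<and> (\<forall>x. x \<noteq> 0 \<longrightarrow> b x x > 0)"

definition skew_symmetric_form :: "('a::real_vector \<Rightarrow> 'a \<Rightarrow> real) \<Rightarrow> bool" where
  "skew_symmetric_form w \<longleftrightarrow> bilinear w \<and> (\<forall>x y. w x y = - w y x)"

text \<open>Triviality of the left radical; for symmetric and skew-symmetric forms the left and right
  radicals coincide.\<close>

definition nondegenerate_form :: "('a::real_vector \<Rightarrow> 'a \<Rightarrow> real) \<Rightarrow> bool" where
  "nondegenerate_form w \<longleftrightarrow> (\<forall>x. (\<forall>y. w x y = 0) \<longrightarrow> x = 0)"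

definition complex_structure :: "('a::real_vector \<Rightarrow> 'a) \<Rightarrow> bool" where
  "complex_structure J \<longleftrightarrow> linear J \<and> (\<forall>x. J (J x) = - x)"

end

theory Submission
  imports Defs "HOL-Computational_Algebra.Fundamental_Theorem_Algebra"
begin

text \<open>
  Write \<open>\<omega> x y = b (A x) y\<close>. The operator \<open>A\<close> is skew-adjoint and injective, so
  \<open>S = - A\<^sup>2\<close> is self-adjoint and positive definite, and \<open>J = A S\<^sup>-\<^sup>1\<^sup>/\<^sup>2\<close>, the orthogonal factor
  in the polar decomposition of \<open>A\<close>, is the required complex structure.

  The inverse square root is taken inside the algebra of real polynomials in \<open>S\<close>, which avoids
  eigenbases, limits and compactness. By finite dimension some nonzero polynomial annihilates \<open>S\<close>.
  Positivity permits cancelling every factor of it that belongs to a non-real or non-positive root,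
  and self-adjointness permits cancelling repeated factors, so \<open>S\<close> is annihilated by
  \<open>\<Prod>\<lambda>\<in>L. (X - \<lambda>)\<close> for a finite set \<open>L\<close> of positive reals. Interpolating
  \<open>\<lambda> \<mapsto> \<lambda>\<^sup>-\<^sup>1\<^sup>/\<^sup>4\<close> on \<open>L\<close> gives a self-adjoint \<open>Q = q(S)\<close> with \<open>Q\<^sup>4 S = id\<close>,
  and \<open>J = A Q\<^sup>2\<close>; writing the inverse square root as the square \<open>Q\<^sup>2\<close> makes the positivity of
  \<open>\<omega> x (J y)\<close> visible.

  For uniqueness, another solution \<open>K\<close> commutes with \<open>A\<close>, because it preserves both forms, hence
  with every polynomial in \<open>S\<close> and with \<open>J\<close>. Then \<open>(J + K) (J - K) = J\<^sup>2 - K\<^sup>2 = 0\<close>, whereas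
  \<open>J + K\<close> is injective since \<open>\<omega> z ((J + K) z) > 0\<close> for \<open>z \<noteq> 0\<close>.
\<close>

section \<open>Polynomials in a linear operator\<close>

definition poly_op :: "('v::real_vector \<Rightarrow> 'v) \<Rightarrow> real poly \<Rightarrow> 'v \<Rightarrow> 'v" where
  "poly_op T p x = (\<Sum>i\<le>degree p. coeff p i *\<^sub>R (T ^^ i) x)"

lemma poly_op_0 [simp]: "poly_op T 0 x = 0"
  by (simp add: poly_op_def)

lemma poly_op_pCons [simp]:
  assumes "linear T"
  shows "poly_op T (pCons a p) x = a *\<^sub>R x + T (poly_op T p x)"
proof (cases "p = 0")
  case True
  then show ?thesis using linear_0[OF assms] by (simp add: poly_op_def)
next
  case False
  then show ?thesis
    by (simp add: poly_op_def sum.atMost_Suc_shift linear_sum[OF assms] linear_cmul[OF assms]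
          del: sum.atMost_Suc)
qed

lemma poly_op_1 [simp]: "linear T \<Longrightarrow> poly_op T 1 x = x"
  by (simp add: one_pCons linear_0)

lemma poly_op_add [simp]:
  assumes "linear T"
  shows "poly_op T (p + q) x = poly_op T p x + poly_op T q x"
  by (induction p q rule: poly_induct2)
     (simp_all add: assms linear_add[OF assms] scaleR_add_left)

lemma poly_op_smult [simp]:
  assumes "linear T"
  shows "poly_op T (smult c p) x = c *\<^sub>R poly_op T p x"
  by (induction p) (simp_all add: assms linear_cmul[OF assms] scaleR_add_right)

lemma poly_op_diff [simp]:
  assumes "linear T"
  shows "poly_op T (p - q) x = poly_op T p x - poly_op T q x"
  using poly_op_add[OF assms, of "p - q" q x] by (simp add: algebra_simps)

lemma poly_op_sum:
  assumes "linear T"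
  shows "poly_op T (\<Sum>i\<in>I. f i) x = (\<Sum>i\<in>I. poly_op T (f i) x)"
  by (induction I rule: infinite_finite_induct) (simp_all add: assms)

lemma poly_op_monom:
  assumes "linear T"
  shows "poly_op T (monom c n) x = c *\<^sub>R (T ^^ n) x"
  by (induction n) (simp_all add: assms monom_0 monom_Suc linear_0 linear_cmul)

lemma poly_op_mult:
  assumes "linear T"
  shows "poly_op T (p * q) x = poly_op T p (poly_op T q x)"
  by (induction p) (simp_all add: assms)

lemma poly_op_commute:
  assumes "linear T" "linear C" "\<And>x. C (T x) = T (C x)"
  shows "C (poly_op T p x) = poly_op T p (C x)"
  by (induction p) (simp_all add: assms linear_0 linear_add linear_cmul)

lemma linear_poly_op:
  assumes "linear T"
  shows "linear (poly_op T p)"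
proof (induction p)
  case 0
  then show ?case by (auto intro!: linearI)
next
  case (pCons a p)
  then show ?case
    by (intro linearI)
       (simp_all add: assms linear_add[OF assms] linear_cmul[OF assms] linear_add[OF pCons(2)]
          linear_cmul[OF pCons(2)] algebra_simps)
qed

text \<open>For a single vector \<open>e\<close> the vectors \<open>e, T e, T\<^sup>2 e, \<dots>\<close> must become linearly dependent.\<close>

lemma ex_annihilating_poly_vector:
  fixes T :: "'v::real_vector \<Rightarrow> 'v"
  assumes T: "linear T" and fin: "finite (B :: 'v set)" and span: "span B = UNIV"
  shows "\<exists>p. p \<noteq> 0 \<and> poly_op T p e = 0"
proof (cases "inj_on (\<lambda>i. (T ^^ i) e) {..card B}")
  case False
  then obtain i j where ij: "i \<noteq> j" "(T ^^ i) e = (T ^^ j) e"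
    by (auto simp: inj_on_def)
  have "coeff (monom 1 i - monom (1::real) j) i \<noteq> 0"
    using ij(1) by simp
  then have "monom 1 i - monom (1::real) j \<noteq> 0"
    by (metis coeff_0)
  moreover have "poly_op T (monom 1 i - monom 1 j) e = 0"
    using ij(2) by (simp add: T poly_op_monom)
  ultimately show ?thesis by blast
next
  case True
  let ?W = "(\<lambda>i. (T ^^ i) e) ` {..card B}"
  have "card ?W = Suc (card B)"
    using card_image[OF True] by simp
  then have "dependent ?W"
    using independent_span_bound[OF fin, of ?W] span by fastforce
  then obtain u where u: "\<exists>v\<in>?W. u v \<noteq> 0" "(\<Sum>v\<in>?W. u v *\<^sub>R v) = 0"
    by (subst (asm) dependent_finite) auto
  define p where "p = (\<Sum>i\<le>card B. monom (u ((T ^^ i) e)) i)"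
  obtain k where k: "k \<le> card B" "u ((T ^^ k) e) \<noteq> 0"
    using u(1) by auto
  have "coeff p k = u ((T ^^ k) e)"
    using k(1) by (simp add: p_def coeff_sum)
  then have "p \<noteq> 0"
    using k(2) by auto
  moreover have "poly_op T p e = 0"
    using u(2) unfolding sum.reindex[OF True]
    by (simp add: p_def poly_op_sum[OF T] poly_op_monom[OF T])
  ultimately show ?thesis by blast
qed

lemma ex_annihilating_poly:
  fixes T :: "'v::real_vector \<Rightarrow> 'v"
  assumes T: "linear T" and fin: "finite (B :: 'v set)" and span: "span B = UNIV"
  shows "\<exists>p. p \<noteq> 0 \<and> (\<forall>x. poly_op T p x = 0)"
proof -
  have "\<exists>p. p \<noteq> 0 \<and> (\<forall>x\<in>C. poly_op T p x = 0)" if "finite C" for C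
    using that
  proof (induction C)
    case empty
    then show ?case by (auto intro: exI[of _ 1])
  next
    case (insert e C)
    then obtain p where p: "p \<noteq> 0" "\<forall>x\<in>C. poly_op T p x = 0" by blast
    obtain q where q: "q \<noteq> 0" "poly_op T q e = 0"
      using ex_annihilating_poly_vector[OF T fin span] by blast
    have "poly_op T (p * q) e = 0"
      using q(2) linear_0[OF linear_poly_op[OF T]] by (simp add: poly_op_mult[OF T])
    moreover have "poly_op T (q * p) x = 0" if "x \<in> C" for x
      using p(2) that linear_0[OF linear_poly_op[OF T]] by (simp add: poly_op_mult[OF T])
    ultimately show ?case
      using p(1) q(1) by (intro exI[of _ "p * q"]) (auto simp: mult.commute)
  qed
  then obtain p where p: "p \<noteq> 0" "\<forall>x\<in>B. poly_op T p x = 0"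
    using fin by blast
  have "poly_op T p x = 0" for x
    using linear_eq_0_on_span[OF linear_poly_op[OF T], of B p x] p(2) span by auto
  then show ?thesis using p(1) by blast
qed

section \<open>Real polynomials\<close>

text \<open>The real linear factors and the quadratic factors without real roots are treated alike:
  a complex root \<open>a + \<i> c\<close> of a real polynomial is shared by its real quadratic factor, so that the
  remainder \<open>u + v X\<close> modulo that factor vanishes at \<open>a + \<i> c\<close>; if \<open>c \<noteq> 0\<close>, this forces
  \<open>u = v = 0\<close>.\<close>

lemma real_poly_factor:
  fixes p :: "real poly"
  assumes "degree p \<noteq> 0"
  shows "(\<exists>a. [:- a, 1:] dvd p) \<or> (\<exists>a c. c \<noteq> 0 \<and> [:a\<^sup>2 + c\<^sup>2, - 2 * a, 1:] dvd p)"
proof -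
  have "\<not> constant (poly (map_poly complex_of_real p))"
    using assms by (simp add: constant_degree degree_map_poly)
  then obtain z where z: "poly (map_poly complex_of_real p) z = 0"
    using fundamental_theorem_of_algebra by blast
  define a c where "a = Re z" and "c = Im z"
  show ?thesis
  proof (cases "c = 0")
    case True
    then have "z = of_real a"
      by (simp add: a_def c_def complex_eq_iff)
    moreover have "poly (map_poly complex_of_real p) (of_real a) = of_real (poly p a)"
      by (induction p) (simp_all add: map_poly_pCons)
    ultimately have "poly p a = 0"
      using z by simp
    then show ?thesis by (auto simp: poly_eq_0_iff_dvd)
  next
    case False
    define g where "g = [:a\<^sup>2 + c\<^sup>2, - 2 * a, 1:]"
    have "degree (p mod g) < 2"
      using degree_mod_less'[of g p] by (cases "p mod g = 0") (auto simp: g_def)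
    then have "p mod g = [:coeff (p mod g) 0, coeff (p mod g) 1:]"
      by (intro poly_eqI) (auto simp: coeff_pCons coeff_eq_0 split: nat.split)
    then obtain u v where uv: "p mod g = [:u, v:]" by blast
    have gz: "poly (map_poly complex_of_real g) z = 0"
      by (simp add: g_def map_poly_pCons a_def c_def complex_eq_iff power2_eq_square algebra_simps)
    have hom: "map_poly complex_of_real (r * s + t) =
        map_poly complex_of_real r * map_poly complex_of_real s + map_poly complex_of_real t"
      for r s t
      by (rule poly_eqI) (simp add: coeff_map_poly coeff_mult)
    have "p = g * (p div g) + [:u, v:]"
      by (simp add: uv[symmetric])
    then have "map_poly complex_of_real p =
        map_poly complex_of_real g * map_poly complex_of_real (p div g)
        + map_poly complex_of_real [:u, v:]"
      by (metis hom)
    then have "poly (map_poly complex_of_real [:u, v:]) z = 0"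
      using z gz by simp
    then have "v * c = 0" "u + v * a = 0"
      by (auto simp: map_poly_pCons complex_eq_iff a_def c_def mult.commute)
    then have "p mod g = 0"
      using False uv by auto
    then show ?thesis
      using False by (auto simp: g_def mod_eq_0_iff_dvd)
  qed
qed

lemma prod_linear_factors_dvd:
  fixes h :: "'a::field poly"
  assumes "finite L" "\<And>l. l \<in> L \<Longrightarrow> poly h l = 0"
  shows "(\<Prod>l\<in>L. [:- l, 1:]) dvd h"
  using assms
proof (induction L)
  case empty
  then show ?case by simp
next
  case (insert a L)
  then obtain k where k: "h = (\<Prod>l\<in>L. [:- l, 1:]) * k" unfolding dvd_def by auto
  have "poly (\<Prod>l\<in>L. [:- l, 1:]) a \<noteq> 0"
    using insert.hyps by (auto simp: poly_prod)
  then have "poly k a = 0"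
    using insert.prems[of a] k by simp
  then have "[:- a, 1:] dvd k"
    by (simp add: poly_eq_0_iff_dvd)
  then show ?case
    using insert.hyps k by (simp add: mult_dvd_mono mult.commute del: mult_pCons_left mult_pCons_right)
qed

lemma ex_interpolating_poly:
  fixes f :: "'a::field \<Rightarrow> 'a"
  assumes "finite L"
  shows "\<exists>p. \<forall>l\<in>L. poly p l = f l"
  using assms
proof (induction L)
  case empty
  then show ?case by simp
next
  case (insert a L)
  then obtain p where p: "\<forall>l\<in>L. poly p l = f l" by blast
  define m where "m = (\<Prod>l\<in>L. [:- l, 1:])"
  have m: "poly m a \<noteq> 0" "\<forall>l\<in>L. poly m l = 0"
    using insert.hyps by (auto simp: m_def poly_prod)
  show ?case
    using p m by (intro exI[of _ "p + smult ((f a - poly p a) / poly m a) m"]) simp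
qed

section \<open>Positive self-adjoint operators\<close>

lemma metric_formD:
  assumes "metric_form b"
  shows "bilinear b" "b x y = b y x" "x \<noteq> 0 \<Longrightarrow> b x x > 0"
  using assms by (auto simp: metric_form_def)

lemma metric_form_eq_0:
  assumes "metric_form b" "b x x \<le> 0"
  shows "x = 0"
  using assms metric_formD(3) by fastforce

lemma metric_form_cancel:
  assumes b: "metric_form b" and eq: "\<And>y. b u y = b v y"
  shows "u = v"
proof -
  have "b (u - v) (u - v) = 0"
    using eq by (simp add: bilinear_lsub[OF metric_formD(1)[OF b]])
  then show ?thesis
    using metric_form_eq_0[OF b, of "u - v"] by simp
qed

lemma poly_op_self_adjoint:
  assumes b: "bilinear b" and T: "linear T" and sa: "\<And>x y. b (T x) y = b x (T y)"
  shows "b (poly_op T p x) y = b x (poly_op T p y)"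
proof (induction p arbitrary: x y)
  case 0
  then show ?case by (simp add: bilinear_lzero[OF b] bilinear_rzero[OF b])
next
  case (pCons a p)
  have "b (T (poly_op T p x)) y = b x (poly_op T p (T y))"
    by (simp add: sa pCons)
  also have "\<dots> = b x (T (poly_op T p y))"
    using poly_op_commute[OF T T, of p y] by simp
  finally show ?case
    by (simp add: T bilinear_ladd[OF b] bilinear_radd[OF b] bilinear_lmul[OF b] bilinear_rmul[OF b])
qed

text \<open>The diagonalisability of \<open>S\<close> with positive eigenvalues, in a form fit for induction on the
  degree, since cofactors of \<open>p\<close> annihilate only part of the space. Splitting off a factor with a non-real or
  non-positive root leaves the kernel unchanged, since \<open>(S - a)\<^sup>2 + c\<^sup>2\<close> with \<open>c \<noteq> 0\<close>, and
  \<open>S - a\<close> with \<open>a \<le> 0\<close>, are positive definite and hence injective. A repeated root \<open>a\<close> can be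
  dropped since \<open>b ((S - a)\<^sup>2 y) y = b ((S - a) y) ((S - a) y)\<close>.\<close>

lemma kernel_poly_op_positive:
  fixes S :: "'v::real_vector \<Rightarrow> 'v"
  assumes b: "metric_form b" and S: "linear S"
    and sa: "\<And>x y. b (S x) y = b x (S y)" and pos: "\<And>x. x \<noteq> 0 \<Longrightarrow> b (S x) x > 0"
    and "p \<noteq> 0"
  shows "\<exists>L. finite L \<and> (\<forall>l\<in>L. l > 0) \<and>
    (\<forall>x. poly_op S p x = 0 \<longrightarrow> poly_op S (\<Prod>l\<in>L. [:- l, 1:]) x = 0)"
  using \<open>p \<noteq> 0\<close>
proof (induction "degree p" arbitrary: p rule: less_induct)
  case less
  note bil = metric_formD(1)[OF b]
  note bsimps = bilinear_ladd[OF bil] bilinear_radd[OF bil] bilinear_lsub[OF bil]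
    bilinear_rsub[OF bil] bilinear_lmul[OF bil] bilinear_rmul[OF bil] bilinear_lneg[OF bil]
    bilinear_rneg[OF bil] bilinear_lzero[OF bil] bilinear_rzero[OF bil]
  note lin0 = linear_0[OF S]
  have square_kernel: "poly_op S [:- a, 1:] y = 0"
    if "poly_op S ([:- a, 1:] * [:- a, 1:]) y = 0" for a y
  proof -
    have "b (poly_op S [:- a, 1:] y) (poly_op S [:- a, 1:] y) = 0"
      using that poly_op_self_adjoint[of b S "[:- a, 1:]" "poly_op S [:- a, 1:] y" y, OF bil S sa]
      by (simp only: poly_op_mult[OF S] bilinear_lzero[OF bil])
    then show ?thesis
      by (intro metric_form_eq_0[OF b]) simp
  qed
  have cancel: ?case if g: "p = g * q" "degree g > 0" and inj: "\<And>y. poly_op S g y = 0 \<Longrightarrow> y = 0"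
    for g q
  proof -
    have "q \<noteq> 0" "degree q < degree p"
      using g less.prems by (auto simp: degree_mult_eq)
    then obtain L where "finite L" "\<forall>l\<in>L. l > 0"
      "\<forall>x. poly_op S q x = 0 \<longrightarrow> poly_op S (\<Prod>l\<in>L. [:- l, 1:]) x = 0"
      using less.hyps by blast
    then show ?thesis
      using inj unfolding g(1) poly_op_mult[OF S] by blast
  qed
  show ?case
  proof (cases "degree p = 0")
    case True
    then obtain c where "p = [:c:]" "c \<noteq> 0"
      using less.prems by (auto elim!: degree_eq_zeroE)
    then show ?thesis
      by (intro exI[of _ "{}"]) (simp add: S lin0)
  next
    case False
    from real_poly_factor[OF this] consider
      (linear) a q where "p = [:- a, 1:] * q"
    | (quadratic) a c q where "c \<noteq> 0" "p = [:a\<^sup>2 + c\<^sup>2, - 2 * a, 1:] * q"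
      unfolding dvd_def by blast
    then show ?thesis
    proof cases
      case quadratic
      show ?thesis
      proof (rule cancel[OF quadratic(2)])
        fix y assume y: "poly_op S [:a\<^sup>2 + c\<^sup>2, - 2 * a, 1:] y = 0"
        let ?z = "S y - a *\<^sub>R y"
        have "b (poly_op S [:a\<^sup>2 + c\<^sup>2, - 2 * a, 1:] y) y = b ?z ?z + c\<^sup>2 * b y y"
          by (simp add: S lin0 bsimps linear_add[OF S] linear_diff[OF S] linear_cmul[OF S] linear_neg[OF S]
                sa[of "S y" y] metric_formD(2)[OF b, of y "S y"] power2_eq_square algebra_simps)
        then have eq: "b ?z ?z + c\<^sup>2 * b y y = 0"
          by (simp only: y bsimps)
        have "b ?z ?z \<ge> 0"
          using metric_formD(3)[OF b, of ?z] bilinear_lzero[OF bil] by (cases "?z = 0") auto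
        then have "c\<^sup>2 * b y y \<le> 0"
          using eq by linarith
        then have "b y y \<le> 0"
          using quadratic(1) by (simp add: mult_le_0_iff)
        then show "y = 0"
          using metric_form_eq_0[OF b] by blast
      qed simp
    next
      case linear
      show ?thesis
      proof (cases "a > 0")
        case False
        show ?thesis
        proof (rule cancel[OF linear])
          fix y assume y: "poly_op S [:- a, 1:] y = 0"
          then have "S y = a *\<^sub>R y"
            by (simp add: S lin0)
          then have "b (S y) y = a * b y y"
            by (simp add: bsimps)
          then show "y = 0"
            using pos[of y] metric_formD(3)[OF b, of y] False
            by (smt (verit, best) mult_nonpos_nonneg)
        qed simp
      next
        case True
        have "q \<noteq> 0" "degree q < degree p"
          using linear less.prems by (auto simp: degree_mult_eq simp del: mult_pCons_left)
        then obtain L where L: "finite L" "\<forall>l\<in>L. l > 0"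
          "\<forall>x. poly_op S q x = 0 \<longrightarrow> poly_op S (\<Prod>l\<in>L. [:- l, 1:]) x = 0"
          using less.hyps by blast
        have "poly_op S (\<Prod>l\<in>insert a L. [:- l, 1:]) x = 0" if "poly_op S p x = 0" for x
        proof -
          have "poly_op S q (poly_op S [:- a, 1:] x) = 0"
            using that unfolding linear by (subst (asm) mult.commute) (simp only: poly_op_mult[OF S])
          then have *: "poly_op S ((\<Prod>l\<in>L. [:- l, 1:]) * [:- a, 1:]) x = 0"
            using L(3) by (simp only: poly_op_mult[OF S])
          show ?thesis
          proof (cases "a \<in> L")
            case False
            then show ?thesis
              using * L(1) by (simp add: mult.commute del: mult_pCons_left mult_pCons_right)
          next
            case True
            define m where "m = (\<Prod>l\<in>L - {a}. [:- l, 1:])"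
            have m: "(\<Prod>l\<in>L. [:- l, 1:]) = [:- a, 1:] * m"
              unfolding m_def using True L(1) by (rule prod.remove[rotated])
            have "(\<Prod>l\<in>L. [:- l, 1:]) * [:- a, 1:] = ([:- a, 1:] * [:- a, 1:]) * m"
              unfolding m by (simp only: ac_simps)
            then have "poly_op S ([:- a, 1:] * [:- a, 1:]) (poly_op S m x) = 0"
              using * by (simp only: poly_op_mult[OF S])
            from square_kernel[OF this] show ?thesis
              using True by (simp only: insert_absorb m poly_op_mult[OF S])
          qed
        qed
        then show ?thesis
          using L True by (intro exI[of _ "insert a L"]) auto
      qed
    qed
  qed
qed

text \<open>This is \<open>S\<^sup>-\<^sup>1\<^sup>/\<^sup>4\<close>, obtained by interpolation on the finite spectrum.\<close>

lemma ex_inverse_fourth_root_poly: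
  fixes S :: "'v::real_vector \<Rightarrow> 'v"
  assumes fin: "finite (B :: 'v set)" "span B = UNIV"
    and b: "metric_form b" and S: "linear S"
    and sa: "\<And>x y. b (S x) y = b x (S y)" and pos: "\<And>x. x \<noteq> 0 \<Longrightarrow> b (S x) x > 0"
  shows "\<exists>q. \<forall>x. poly_op S q (poly_op S q (poly_op S q (poly_op S q (S x)))) = x"
proof -
  obtain p where p: "p \<noteq> 0" "\<forall>x. poly_op S p x = 0"
    using ex_annihilating_poly[OF S fin] by blast
  obtain L where L: "finite L" "\<forall>l\<in>L. l > 0" "\<forall>x. poly_op S (\<Prod>l\<in>L. [:- l, 1:]) x = 0"
    using kernel_poly_op_positive[of b S p, OF b S sa pos p(1)] p(2) by blast
  obtain q where q: "\<forall>l\<in>L. poly q l = inverse (root 4 l)"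
    using ex_interpolating_poly[OF L(1), of "\<lambda>l. inverse (root 4 l)"] by blast
  define h where "h = q * (q * (q * (q * [:0, 1:]))) - 1"
  have "poly h l = 0" if "l \<in> L" for l
  proof -
    have "l > 0" using L(2) that by blast
    then have "root 4 l ^ 4 = l" "root 4 l \<noteq> 0" by auto
    moreover have "poly h l = inverse (root 4 l) ^ 4 * l - 1"
      using q that by (simp add: h_def power4_eq_xxxx)
    ultimately show ?thesis
      by (metis power_inverse left_inverse power_not_zero diff_self)
  qed
  then obtain k where k: "h = k * (\<Prod>l\<in>L. [:- l, 1:])"
    using prod_linear_factors_dvd[OF L(1), of h] by (metis dvd_def mult.commute)
  have "poly_op S h x = 0" for x
    using L(3) linear_0[OF linear_poly_op[OF S]] by (simp add: k poly_op_mult[OF S])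
  then have "poly_op S q (poly_op S q (poly_op S q (poly_op S q (S x)))) = x" for x
    by (simp add: h_def poly_op_mult[OF S] S linear_0[OF S] del: mult_pCons_right)
  then show ?thesis by blast
qed

section \<open>Representing a bilinear form by an operator\<close>

text \<open>Riesz representation on a finitely generated subspace. Adjoining \<open>v\<close> to \<open>B\<close>, the induction
  hypothesis for the functional \<open>b v\<close> supplies the orthogonal projection of \<open>v\<close> to \<open>span B\<close>.\<close>

lemma riesz_representation_span:
  fixes b :: "'v::real_vector \<Rightarrow> 'v \<Rightarrow> real"
  assumes b: "metric_form b" and "finite B" and "linear f"
  shows "\<exists>a\<in>span B. \<forall>y\<in>span B. f y = b a y"
  using \<open>finite B\<close> \<open>linear f\<close>
proof (induction B arbitrary: f)
  case empty
  then show ?case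
    using bilinear_lzero[OF metric_formD(1)[OF b]] by (simp add: linear_0)
next
  case (insert v B)
  note bil = metric_formD(1)[OF b]
  have "linear (b v)"
    using bil by (simp add: bilinear_def)
  then obtain w where w: "w \<in> span B" "\<forall>y\<in>span B. b v y = b w y"
    using insert.IH by blast
  obtain a where a: "a \<in> span B" "\<forall>y\<in>span B. f y = b a y"
    using insert.IH insert.prems by blast
  define u where "u = v - w"
  have u_orth: "b u y = 0" "b y u = 0" if "y \<in> span B" for y
    using w(2) that metric_formD(2)[OF b] by (auto simp: u_def bilinear_lsub[OF bil] bilinear_rsub[OF bil])
  have span_sub: "span B \<subseteq> span (insert v B)"
    by (intro span_mono) auto
  define a' where "a' = a + (f u / b u u) *\<^sub>R u"
  have "a' \<in> span (insert v B)"
    unfolding a'_def u_def using a(1) w(1) span_sub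
    by (intro span_add span_scale span_diff) (auto intro: span_base)
  moreover have "f y = b a' y" if "y \<in> span (insert v B)" for y
  proof -
    obtain t where t: "y - t *\<^sub>R v \<in> span B"
      using \<open>y \<in> span (insert v B)\<close> span_breakdown_eq by blast
    define y' where "y' = (y - t *\<^sub>R v) + t *\<^sub>R w"
    have y': "y' \<in> span B"
      unfolding y'_def using t w(1) by (intro span_add span_scale)
    have y: "y = y' + t *\<^sub>R u"
      by (simp add: y'_def u_def algebra_simps)
    have "f u = (f u / b u u) * b u u"
      using metric_formD(3)[OF b, of u] linear_0[OF insert.prems] by (cases "u = 0") auto
    then show ?thesis
      using a(2) y' u_orth[OF y'] u_orth[OF a(1)]
      by (simp add: y a'_def linear_add[OF insert.prems] linear_cmul[OF insert.prems]
          bilinear_ladd[OF bil] bilinear_radd[OF bil] bilinear_lmul[OF bil] bilinear_rmul[OF bil])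
  qed
  ultimately show ?case by blast
qed

lemma ex_representing_operator:
  fixes b w :: "'v::real_vector \<Rightarrow> 'v \<Rightarrow> real"
  assumes fin: "finite (B :: 'v set)" "span B = UNIV" and b: "metric_form b" and w: "bilinear w"
  shows "\<exists>A. linear A \<and> (\<forall>x y. w x y = b (A x) y)"
proof -
  note bil = metric_formD(1)[OF b]
  have "\<exists>a. \<forall>y. w x y = b a y" for x
    using riesz_representation_span[OF b fin(1), of "w x"] w fin(2) by (auto simp: bilinear_def)
  then obtain A where A: "\<And>x y. w x y = b (A x) y"
    by metis
  have "linear A"
  proof (rule linearI)
    fix x y
    show "A (x + y) = A x + A y"
      by (rule metric_form_cancel[OF b])
         (simp add: bilinear_ladd[OF bil] A[symmetric] bilinear_ladd[OF w])
  next
    fix r x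
    show "A (r *\<^sub>R x) = r *\<^sub>R A x"
      by (rule metric_form_cancel[OF b])
         (simp add: bilinear_lmul[OF bil] A[symmetric] bilinear_lmul[OF w])
  qed
  then show ?thesis using A by blast
qed

section \<open>The compatible complex structure\<close>

text \<open>Commutation gives \<open>(J + K) (J - K) = J\<^sup>2 - K\<^sup>2 = 0\<close>, and \<open>J + K\<close> is injective by positivity.\<close>

lemma commuting_tame_complex_structures_eq:
  fixes w :: "'v::real_vector \<Rightarrow> 'v \<Rightarrow> real"
  assumes w: "bilinear w" and J: "complex_structure J" and K: "complex_structure K"
    and comm: "\<And>x. J (K x) = K (J x)"
    and posJ: "\<And>x. x \<noteq> 0 \<Longrightarrow> w x (J x) > 0" and posK: "\<And>x. x \<noteq> 0 \<Longrightarrow> w x (K x) > 0"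
  shows "J = K"
proof
  fix x
  define y where "y = J x - K x"
  have lin: "linear J" "linear K" and sq: "\<And>z. J (J z) = - z" "\<And>z. K (K z) = - z"
    using J K by (auto simp: complex_structure_def)
  have "J y + K y = 0"
    by (simp add: y_def linear_diff[OF lin(1)] linear_diff[OF lin(2)] sq comm)
  then have "w y (J y) + w y (K y) = 0"
    by (metis bilinear_radd[OF w] bilinear_rzero[OF w])
  then have "y = 0"
    using posJ[of y] posK[of y] by fastforce
  then show "J x = K x"
    by (simp add: y_def)
qed

theorem proposition6p2:
  fixes b \<omega> :: "'v::real_vector \<Rightarrow> 'v \<Rightarrow> real"
  assumes finite_dim:
      "\<exists>B. finite_dimensional_vector_space ((*\<^sub>R) :: real \<Rightarrow> 'v \<Rightarrow> 'v) B"
    and metric: "metric_form b"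
    and skew: "skew_symmetric_form \<omega>"
    and nondegenerate: "nondegenerate_form \<omega>"
  shows "\<exists>!J. complex_structure J \<and>
    (\<forall>x y. b (J x) (J y) = b x y) \<and>
    (\<forall>x y. \<omega> (J x) (J y) = \<omega> x y) \<and>
    metric_form (\<lambda>x y. \<omega> x (J y))"
proof -
  obtain B :: "'v set" where "finite_dimensional_vector_space ((*\<^sub>R) :: real \<Rightarrow> 'v \<Rightarrow> 'v) B"
    using finite_dim by blast
  then interpret fd: finite_dimensional_vector_space "(*\<^sub>R) :: real \<Rightarrow> 'v \<Rightarrow> 'v" B .
  have fin: "finite B" "span B = UNIV"
    using fd.finite_Basis fd.span_Basis by (simp_all add: span_raw_def)
  note bil = metric_formD(1)[OF metric]
  have \<omega>: "bilinear \<omega>" "\<And>x y. \<omega> x y = - \<omega> y x"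
    using skew unfolding skew_symmetric_form_def by blast+
  obtain A where A: "linear A" "\<And>x y. \<omega> x y = b (A x) y"
    using ex_representing_operator[OF fin metric \<omega>(1)] by blast
  have A_skew: "b (A x) y = - b x (A y)" for x y
    using \<omega>(2)[of x y] metric_formD(2)[OF metric, of x "A y"] by (simp add: A(2))
  have A_inj: "x = 0" if "A x = 0" for x
    using nondegenerate that bilinear_lzero[OF bil] by (auto simp: nondegenerate_form_def A(2))
  define S where "S x = - A (A x)" for x
  have S: "linear S"
    unfolding S_def using A(1)
    by (intro linearI) (simp_all add: linear_add linear_cmul)
  have bSA: "b (S x) y = b (A x) (A y)" for x y
    by (simp add: S_def bilinear_lneg[OF bil] A_skew[of "A x"])
  have S_sa: "b (S x) y = b x (S y)" for x y
    using bSA[of x y] bSA[of y x] metric_formD(2)[OF metric] by metis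
  have S_pos: "b (S x) x > 0" if "x \<noteq> 0" for x
    using bSA A_inj that metric_formD(3)[OF metric] by metis
  obtain q where q: "\<And>x. poly_op S q (poly_op S q (poly_op S q (poly_op S q (S x)))) = x"
    using ex_inverse_fourth_root_poly[of B b S, OF fin metric S S_sa S_pos] by blast
  define Q where "Q = poly_op S q"
  have Q: "linear Q" and Q4: "\<And>x. Q (Q (Q (Q (S x)))) = x"
    and Q_sa: "\<And>x y. b (Q x) y = b x (Q y)"
    using q linear_poly_op[OF S] poly_op_self_adjoint[of b S, OF bil S S_sa] by (simp_all add: Q_def)
  \<comment> \<open>Used for \<open>C = A\<close> and, in the uniqueness part, for a competing complex structure.\<close>
  have Q_comm: "C (Q x) = Q (C x)" if "linear C" "\<And>x. C (A x) = A (C x)" for C x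
    unfolding Q_def using that
    by (intro poly_op_commute[OF S that(1)]) (simp add: S_def linear_neg)
  have AQ: "A (Q x) = Q (A x)" for x
    using Q_comm[OF A(1)] by simp
  have SQ: "S (Q x) = Q (S x)" for x
    by (simp add: S_def AQ linear_neg[OF Q])
  have Q_inj: "x = 0" if "Q x = 0" for x
    using Q4[of x] that linear_0[OF Q] SQ by metis
  define J where "J x = A (Q (Q x))" for x
  have J_lin: "linear J"
    unfolding J_def using A(1) Q
    by (intro linearI) (simp_all add: linear_add linear_cmul)
  have "J (J x) = - x" for x
  proof -
    have "J (J x) = - S (Q (Q (Q (Q x))))"
      by (simp add: J_def AQ S_def)
    then show ?thesis
      by (simp add: SQ Q4)
  qed
  with J_lin have J: "complex_structure J"
    by (simp add: complex_structure_def)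
  have Jb: "b (J x) (J y) = b x y" for x y
  proof -
    have "b (J x) (J y) = b (S (Q (Q x))) (Q (Q y))"
      by (simp add: J_def bSA)
    also have "\<dots> = b (Q (Q (Q (Q (S x))))) y"
      by (simp add: SQ Q_sa)
    finally show ?thesis
      by (simp add: Q4)
  qed
  have J\<omega>: "\<omega> (J x) (J y) = \<omega> x y" for x y
  proof -
    have "A (J x) = J (A x)"
      by (simp add: J_def AQ)
    then show ?thesis
      by (simp add: A(2) Jb)
  qed
  have \<omega>J: "\<omega> x (J y) = b (A (Q x)) (A (Q y))" for x y
    by (simp add: A(2) J_def AQ Q_sa)
  have Jpos: "metric_form (\<lambda>x y. \<omega> x (J y))"
    unfolding metric_form_def
  proof (intro conjI allI impI)
    show "bilinear (\<lambda>x y. \<omega> x (J y))"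
      unfolding bilinear_def
      by (auto intro!: linearI simp: linear_add[OF J_lin] linear_cmul[OF J_lin]
            bilinear_ladd[OF \<omega>(1)] bilinear_radd[OF \<omega>(1)]
            bilinear_lmul[OF \<omega>(1)] bilinear_rmul[OF \<omega>(1)])
    show "\<omega> x (J y) = \<omega> y (J x)" for x y
      unfolding \<omega>J by (rule metric_formD(2)[OF metric])
    show "\<omega> x (J x) > 0" if "x \<noteq> 0" for x
      unfolding \<omega>J using A_inj Q_inj that metric_formD(3)[OF metric] by metis
  qed
  show ?thesis
  proof (rule ex1I[of _ J])
    show "complex_structure J \<and> (\<forall>x y. b (J x) (J y) = b x y) \<and>
      (\<forall>x y. \<omega> (J x) (J y) = \<omega> x y) \<and> metric_form (\<lambda>x y. \<omega> x (J y))"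
      using J Jb J\<omega> Jpos by blast
  next
    fix K
    assume "complex_structure K \<and> (\<forall>x y. b (K x) (K y) = b x y) \<and>
      (\<forall>x y. \<omega> (K x) (K y) = \<omega> x y) \<and> metric_form (\<lambda>x y. \<omega> x (K y))"
    then have K: "complex_structure K" and Kb: "\<And>x y. b (K x) (K y) = b x y"
      and K\<omega>: "\<And>x y. \<omega> (K x) (K y) = \<omega> x y" and Kpos: "metric_form (\<lambda>x y. \<omega> x (K y))"
      by blast+
    have K_lin: "linear K" and K_sq: "\<And>x. K (K x) = - x"
      using K by (auto simp: complex_structure_def)
    \<comment> \<open>\<open>b (A (K x)) (K y) = \<omega> (K x) (K y) = \<omega> x y = b (A x) y = b (K (A x)) (K y)\<close>\<close>
    have KA: "K (A x) = A (K x)" for x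
    proof (rule metric_form_cancel[OF metric])
      fix y
      have y: "y = K (- K y)"
        by (simp add: linear_neg[OF K_lin] K_sq)
      have "b (K (A x)) (K (- K y)) = b (A (K x)) (K (- K y))"
        using K\<omega>[of x "- K y"] by (simp only: Kb A(2))
      then show "b (K (A x)) y = b (A (K x)) y"
        using y by simp
    qed
    have "K (J x) = J (K x)" for x
      by (simp add: J_def KA Q_comm[of K, OF K_lin KA])
    then show "K = J"
      using commuting_tame_complex_structures_eq[OF \<omega>(1) K J]
        metric_formD(3)[OF Kpos] metric_formD(3)[OF Jpos] by blast
  qed
qed

end
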